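(* Let $A$ be a skew left brace such that $A/\operatorname{Ann}(A)$ is finite. Then $A^{(2)}$ and $[A,A]_+$ are finite. The converse holds if the additive group is finitely generated: if $A$ is a skew left brace such that $(A,+)$ is a finitely generated group and both $A^{(2)}$ and $[A,A]_+$ are finite, then $A/\operatorname{Ann}(A)$ is finite.
   Context: A skew left brace is a triple $(A,+,\circ)$ where $(A,+)$ and $(A,\circ)$ are (not necessarily abelian) groups with $a\circ(b+c)=a\circ b-a+a\circ c$ for all $a,b,c\in A$. The map $\lambda\colon(A,\circ)\to\operatorname{Aut}(A,+)$, $\lambda_a(b)=-a+a\circ b$, is a group homomorphism; put $a*b=\lambda_a(b)-b=-a+a\circ b-b$. $A^{(2)}$ is the additive subgroup generated by all $a*b$ with $a,b\in A$. $[A,A]_+$ is the commutator subgroup of $(A,+)$. The socle is $\operatorname{Soc}(A)=\ker\lambda\cap Z(A,+)$ and the annihilator is $\operatorname{Ann}(A)=\operatorname{Soc}(A)\cap Z(A,\circ)$, where $Z$ denotes the center of a group. $\operatorname{Ann}(A)$ is an ideal of $A$, i.e. a normal subgroup of both $(A,+)$ and $(A,\circ)$ stable under all $\lambda_a$, so $A/\operatorname{Ann}(A)$ is a skew left brace. *)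

theory Defs
  imports "HOL-Algebra.QuotRing" "HOL-Algebra.Bij" "HOL-Algebra.Generated_Groups"
begin

section \<open>Skew left braces\<close>

text \<open>
  A skew left brace is carried by a \<^typ>\<open>('a, 'm) ring_scheme\<close> record, whose two operations
  \<open>\<oplus>\<close> and \<open>\<otimes>\<close> stand for \<open>+\<close> and \<open>\<circ>\<close>. No ring axiom is assumed, and \<open>\<oplus>\<close> need not commute:
  the additive group is \<open>add_monoid A\<close> and the multiplicative group is \<open>A\<close> itself, read as a
  \<^typ>\<open>('a, 'm) monoid_scheme\<close>. The record has separate fields for the two neutral elements; they
  coincide by lemma \<open>zero_eq_one\<close> below.
\<close>

locale skew_left_brace =
  fixes A (structure)
  assumes additive_group: "group (add_monoid A)"
    and multiplicative_group: "group A"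
    and brace_distrib:
      "\<lbrakk>a \<in> carrier A; b \<in> carrier A; c \<in> carrier A\<rbrakk>
        \<Longrightarrow> a \<otimes> (b \<oplus> c) = a \<otimes> b \<ominus> a \<oplus> a \<otimes> c"

text \<open>The restriction to the carrier puts \<open>\<lambda>\<^sub>a\<close> into the carrier of \<^const>\<open>AutoGroup\<close>, which
  consists of extensional functions.\<close>

definition brace_lambda :: "('a, 'm) ring_scheme \<Rightarrow> 'a \<Rightarrow> 'a \<Rightarrow> 'a"
  where "brace_lambda A a = (\<lambda>b\<in>carrier A. (\<ominus>\<^bsub>A\<^esub> a) \<oplus>\<^bsub>A\<^esub> a \<otimes>\<^bsub>A\<^esub> b)"

definition brace_star :: "('a, 'm) ring_scheme \<Rightarrow> 'a \<Rightarrow> 'a \<Rightarrow> 'a"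
  where "brace_star A a b = brace_lambda A a b \<ominus>\<^bsub>A\<^esub> b"

definition brace_square :: "('a, 'm) ring_scheme \<Rightarrow> 'a set"
  where "brace_square A =
    generate (add_monoid A) {brace_star A a b | a b. a \<in> carrier A \<and> b \<in> carrier A}"

definition additive_commutator :: "('a, 'm) ring_scheme \<Rightarrow> 'a set"
  where "additive_commutator A = derived (add_monoid A) (carrier A)"

definition group_center :: "('a, 'm) monoid_scheme \<Rightarrow> 'a set"
  where "group_center G = {z \<in> carrier G. \<forall>x\<in>carrier G. z \<otimes>\<^bsub>G\<^esub> x = x \<otimes>\<^bsub>G\<^esub> z}"

definition finitely_generated_group :: "('a, 'm) monoid_scheme \<Rightarrow> bool"
  where "finitely_generated_group G \<longleftrightarrow>
    group G \<and> (\<exists>S. finite S \<and> S \<subseteq> carrier G \<and> generate G S = carrier G)"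

definition Soc :: "('a, 'm) ring_scheme \<Rightarrow> 'a set"
  where "Soc A = kernel A (AutoGroup (add_monoid A)) (brace_lambda A) \<inter> group_center (add_monoid A)"

definition Ann :: "('a, 'm) ring_scheme \<Rightarrow> 'a set"
  where "Ann A = Soc A \<inter> group_center A"

text \<open>
  The quotient brace is the library's \<open>A Quot Ann A\<close>. Its carrier is the set of additive cosets,
  and its operations are those induced from \<open>A\<close>. The library proves facts about \<open>Quot\<close> only for
  ideals of rings, so what is needed here is proved below: \<open>\<lambda>\<close> is a homomorphism into the
  automorphism group, \<open>Ann A\<close> is an ideal of the brace, and \<open>A Quot Ann A\<close> is a skew left brace.
\<close>

lemma group_inv_commute:
  fixes G (structure)
  assumes "group G" "x \<in> carrier G" "y \<in> carrier G" "x \<otimes> y = y \<otimes> x"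
  shows "inv x \<otimes> y = y \<otimes> inv x"
proof -
  interpret group G by fact
  have "inv x \<otimes> y = inv x \<otimes> (y \<otimes> x) \<otimes> inv x"
    using assms by (simp add: m_assoc)
  also have "\<dots> = y \<otimes> inv x"
    using assms by (simp add: assms(4) [symmetric] m_assoc [symmetric])
  finally show ?thesis .
qed

context skew_left_brace
begin

sublocale add: group "add_monoid A"
  rewrites "carrier (add_monoid A) = carrier A"
    and "mult (add_monoid A) = add A"
    and "one (add_monoid A) = zero A"
    and "m_inv (add_monoid A) = a_inv A"
  by (rule additive_group) (simp_all add: a_inv_def)

sublocale mult: group A
  by (rule multiplicative_group)

lemma zero_eq_one: "\<zero> = \<one>"
proof -
  have "\<one> \<otimes> (\<zero> \<oplus> \<zero>) = \<one> \<otimes> \<zero> \<ominus> \<one> \<oplus> \<one> \<otimes> \<zero>"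
    by (rule brace_distrib) simp_all
  then have "\<zero> = \<ominus> \<one>"
    by (simp add: a_minus_def)
  then show ?thesis
    by (metis add.inv_inv add.inv_one mult.one_closed)
qed

lemma lambda_apply: "b \<in> carrier A \<Longrightarrow> brace_lambda A a b = \<ominus> a \<oplus> a \<otimes> b"
  by (simp add: brace_lambda_def)

lemma lambda_closed [simp]:
  "\<lbrakk>a \<in> carrier A; b \<in> carrier A\<rbrakk> \<Longrightarrow> brace_lambda A a b \<in> carrier A"
  by (simp add: lambda_apply)

lemma mult_eq_lambda:
  "\<lbrakk>a \<in> carrier A; b \<in> carrier A\<rbrakk> \<Longrightarrow> a \<otimes> b = a \<oplus> brace_lambda A a b"
  by (simp add: lambda_apply add.m_assoc [symmetric])

lemma lambda_add:
  assumes "a \<in> carrier A" "b \<in> carrier A" "c \<in> carrier A"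
  shows "brace_lambda A a (b \<oplus> c) = brace_lambda A a b \<oplus> brace_lambda A a c"
  using assms by (simp add: lambda_apply brace_distrib a_minus_def add.m_assoc)

lemma lambda_mult:
  assumes "a \<in> carrier A" "b \<in> carrier A" "c \<in> carrier A"
  shows "brace_lambda A (a \<otimes> b) c = brace_lambda A a (brace_lambda A b c)"
proof -
  have "a \<oplus> brace_lambda A a b \<oplus> brace_lambda A (a \<otimes> b) c = (a \<otimes> b) \<otimes> c"
    using assms by (simp add: mult_eq_lambda [symmetric])
  also have "\<dots> = a \<otimes> (b \<oplus> brace_lambda A b c)"
    using assms by (simp add: mult_eq_lambda [symmetric] mult.m_assoc)
  also have "\<dots> = a \<oplus> brace_lambda A a (b \<oplus> brace_lambda A b c)"
    using assms by (intro mult_eq_lambda) simp_all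
  also have "\<dots> = a \<oplus> brace_lambda A a b \<oplus> brace_lambda A a (brace_lambda A b c)"
    using assms by (simp add: lambda_add add.m_assoc)
  finally show ?thesis
    using assms by (metis add.Units_eq add.Units_l_cancel add.m_closed lambda_closed mult.m_closed)
qed

lemma lambda_one: "c \<in> carrier A \<Longrightarrow> brace_lambda A \<one> c = c"
  using zero_eq_one add.inv_one by (simp add: lambda_apply)

lemma lambda_auto:
  assumes a: "a \<in> carrier A"
  shows "brace_lambda A a \<in> auto (add_monoid A)"
proof -
  have "bij_betw (brace_lambda A a) (carrier A) (carrier A)"
  proof (rule bij_betwI)
    show "brace_lambda A a \<in> carrier A \<rightarrow> carrier A"
      using a by auto
    show "brace_lambda A (inv a) \<in> carrier A \<rightarrow> carrier A"
      using a by auto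
    show "brace_lambda A (inv a) (brace_lambda A a x) = x" if "x \<in> carrier A" for x
      using a that by (simp add: lambda_mult [symmetric] lambda_one)
    show "brace_lambda A a (brace_lambda A (inv a) x) = x" if "x \<in> carrier A" for x
      using a that by (simp add: lambda_mult [symmetric] lambda_one)
  qed
  then show ?thesis
    using a by (auto simp: auto_def hom_def Bij_def lambda_add) (simp add: brace_lambda_def)
qed

lemma lambda_hom: "brace_lambda A \<in> hom A (AutoGroup (add_monoid A))"
proof -
  have "brace_lambda A (a \<otimes> b) = compose (carrier A) (brace_lambda A a) (brace_lambda A b)"
    if "a \<in> carrier A" "b \<in> carrier A" for a b
  proof (rule extensionalityI [of _ "carrier A"])
    show "brace_lambda A (a \<otimes> b) \<in> extensional (carrier A)"
      by (simp add: brace_lambda_def)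
    show "compose (carrier A) (brace_lambda A a) (brace_lambda A b) \<in> extensional (carrier A)"
      by (rule compose_extensional)
    show "brace_lambda A (a \<otimes> b) x = compose (carrier A) (brace_lambda A a) (brace_lambda A b) x"
      if x: "x \<in> carrier A" for x
      using \<open>a \<in> carrier A\<close> \<open>b \<in> carrier A\<close> x by (simp add: compose_def lambda_mult)
  qed
  then show ?thesis
    using lambda_auto by (auto simp: hom_def AutoGroup_def BijGroup_def auto_def)
qed

lemma Ann_iff:
  "z \<in> Ann A \<longleftrightarrow> z \<in> carrier A \<and>
    (\<forall>b\<in>carrier A. z \<otimes> b = z \<oplus> b \<and> z \<oplus> b = b \<oplus> z \<and> z \<otimes> b = b \<otimes> z)"
proof -
  have "brace_lambda A z = (\<lambda>b\<in>carrier A. b) \<longleftrightarrow> (\<forall>b\<in>carrier A. z \<otimes> b = z \<oplus> b)"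
    if z: "z \<in> carrier A"
  proof
    assume eq: "brace_lambda A z = (\<lambda>b\<in>carrier A. b)"
    show "\<forall>b\<in>carrier A. z \<otimes> b = z \<oplus> b"
      using z by (simp add: mult_eq_lambda eq)
  next
    assume eq: "\<forall>b\<in>carrier A. z \<otimes> b = z \<oplus> b"
    show "brace_lambda A z = (\<lambda>b\<in>carrier A. b)"
      unfolding brace_lambda_def
      using z eq by (intro restrict_ext) (simp add: add.m_assoc [symmetric])
  qed
  then show ?thesis
    by (auto simp: Ann_def Soc_def kernel_def group_center_def AutoGroup_def BijGroup_def)
qed

lemma Ann_carrier: "z \<in> Ann A \<Longrightarrow> z \<in> carrier A"
  by (simp add: Ann_iff)

lemma Ann_mult: "\<lbrakk>z \<in> Ann A; b \<in> carrier A\<rbrakk> \<Longrightarrow> z \<otimes> b = z \<oplus> b"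
  and Ann_add_commute: "\<lbrakk>z \<in> Ann A; b \<in> carrier A\<rbrakk> \<Longrightarrow> b \<oplus> z = z \<oplus> b"
  and Ann_mult_commute: "\<lbrakk>z \<in> Ann A; b \<in> carrier A\<rbrakk> \<Longrightarrow> b \<otimes> z = z \<otimes> b"
  by (metis Ann_iff)+

lemma AnnI:
  assumes "z \<in> carrier A"
    and "\<And>b. b \<in> carrier A \<Longrightarrow> z \<otimes> b = z \<oplus> b"
    and "\<And>b. b \<in> carrier A \<Longrightarrow> z \<oplus> b = b \<oplus> z"
    and "\<And>b. b \<in> carrier A \<Longrightarrow> z \<otimes> b = b \<otimes> z"
  shows "z \<in> Ann A"
  using assms by (metis Ann_iff)

lemma Ann_add_closed:
  assumes "z \<in> Ann A" "w \<in> Ann A"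
  shows "z \<oplus> w \<in> Ann A"
proof -
  have zw: "z \<in> carrier A" "w \<in> carrier A" "z \<oplus> w = z \<otimes> w"
    using assms by (simp_all add: Ann_carrier Ann_mult)
  have 1: "(z \<oplus> w) \<otimes> b = (z \<oplus> w) \<oplus> b" if b: "b \<in> carrier A" for b
  proof -
    have "(z \<oplus> w) \<otimes> b = z \<otimes> (w \<otimes> b)"
      using b zw by (simp only: mult.m_assoc)
    also have "\<dots> = z \<oplus> (w \<oplus> b)"
      using b zw(1,2) assms by (simp add: Ann_mult)
    finally show ?thesis
      using b zw(1,2) by (simp add: add.m_assoc)
  qed
  have 2: "(z \<oplus> w) \<oplus> b = b \<oplus> (z \<oplus> w)" if b: "b \<in> carrier A" for b
    using assms b zw(1,2) by (metis Ann_add_commute add.m_assoc)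
  have 3: "(z \<otimes> w) \<otimes> b = b \<otimes> (z \<otimes> w)" if b: "b \<in> carrier A" for b
    using assms b zw(1,2) by (metis Ann_mult_commute mult.m_assoc)
  show ?thesis
    by (rule AnnI) (use 1 2 3 zw add.m_closed in metis)+
qed

lemma Ann_minus_closed:
  assumes "z \<in> Ann A"
  shows "\<ominus> z \<in> Ann A" and "inv z = \<ominus> z"
proof -
  have z: "z \<in> carrier A"
    using assms by (rule Ann_carrier)
  have "z \<otimes> \<ominus> z = \<one>"
    using assms z by (simp add: Ann_mult zero_eq_one [symmetric])
  then show i: "inv z = \<ominus> z"
    using z by (metis mult.inv_equality mult.inv_inv mult.inv_closed add.inv_closed)
  have 1: "\<ominus> z \<otimes> b = \<ominus> z \<oplus> b" if b: "b \<in> carrier A" for b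
  proof -
    have "b = z \<otimes> (\<ominus> z \<oplus> b)"
      using assms b z by (simp add: Ann_mult add.m_assoc [symmetric])
    then have "inv z \<otimes> b = \<ominus> z \<oplus> b"
      using b z by (metis mult.inv_solve_left add.inv_closed add.m_closed)
    then show ?thesis
      by (simp add: i)
  qed
  have 2: "\<ominus> z \<oplus> b = b \<oplus> \<ominus> z" if b: "b \<in> carrier A" for b
    using group_inv_commute [OF additive_group, of z b] Ann_add_commute [OF assms b] b z
    by (simp add: a_inv_def)
  have 3: "inv z \<otimes> b = b \<otimes> inv z" if b: "b \<in> carrier A" for b
    using group_inv_commute [OF multiplicative_group z b] Ann_mult_commute [OF assms b]
    by simp
  show "\<ominus> z \<in> Ann A"
    using 1 2 3 z by (intro AnnI) (simp_all add: i)
qed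

lemma zero_in_Ann: "\<zero> \<in> Ann A"
  by (rule AnnI) (simp_all, simp_all add: zero_eq_one)

lemma Ann_normal_add: "Ann A \<lhd> add_monoid A"
proof (rule normal.intro)
  show "subgroup (Ann A) (add_monoid A)"
    using Ann_carrier Ann_add_closed Ann_minus_closed(1) zero_in_Ann
    by (auto simp: subgroup_def a_inv_def [symmetric])
  show "normal_axioms (Ann A) (add_monoid A)"
    unfolding normal_axioms_def r_coset_def l_coset_def
    by (intro ballI SUP_cong) (simp_all, metis Ann_add_commute)
qed (rule additive_group)

lemma Ann_normal_mult: "Ann A \<lhd> A"
proof (rule normal.intro)
  show "subgroup (Ann A) A"
  proof (rule subgroup.intro)
    show "x \<otimes> y \<in> Ann A" if "x \<in> Ann A" "y \<in> Ann A" for x y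
      using Ann_add_closed [OF that] that by (simp add: Ann_mult Ann_carrier)
    show "\<one> \<in> Ann A"
      using zero_in_Ann zero_eq_one by simp
  qed (use Ann_carrier Ann_minus_closed in auto)
  show "normal_axioms (Ann A) A"
    unfolding normal_axioms_def r_coset_def l_coset_def
    by (intro ballI SUP_cong) (simp_all, metis Ann_mult_commute)
qed (rule multiplicative_group)

lemma lambda_Ann:
  assumes "a \<in> carrier A" "z \<in> Ann A"
  shows "brace_lambda A a z = z"
proof -
  have "a \<otimes> z = a \<oplus> z"
    using assms by (metis Ann_mult Ann_mult_commute Ann_add_commute)
  then show ?thesis
    using assms Ann_carrier by (simp add: lambda_apply add.m_assoc [symmetric])
qed

lemma Ann_coset: "Ann A +> a = Ann A #> a" if "a \<in> carrier A"
  using that by (simp add: a_r_coset_def r_coset_def Ann_mult)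

lemma Ann_coset_add:
  "\<lbrakk>a \<in> carrier A; b \<in> carrier A\<rbrakk>
    \<Longrightarrow> set_add A (Ann A +> a) (Ann A +> b) = Ann A +> (a \<oplus> b)"
  using normal.rcos_sum [OF Ann_normal_add] by (simp add: a_r_coset_def set_add_def)

lemma Ann_coset_mult:
  assumes ab: "a \<in> carrier A" "b \<in> carrier A"
  shows "rcoset_mult A (Ann A) (Ann A +> a) (Ann A +> b) = Ann A +> (a \<otimes> b)"
proof -
  interpret N: normal "Ann A" A
    by (rule Ann_normal_mult)
  have *: "Ann A +> (x \<otimes> y) = Ann A +> (a \<otimes> b)" if "x \<in> Ann A +> a" "y \<in> Ann A +> b" for x y
  proof -
    have xy: "x \<in> Ann A #> a" "y \<in> Ann A #> b"
      using that ab Ann_coset by auto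
    then have c: "x \<in> carrier A" "y \<in> carrier A"
      using ab N.subset mult.r_coset_subset_G by blast+
    have "Ann A #> x = Ann A #> a" "Ann A #> y = Ann A #> b"
      using xy ab N.subgroup_axioms mult.repr_independence by metis+
    then have "Ann A #> (x \<otimes> y) = Ann A #> (a \<otimes> b)"
      using c ab by (metis N.rcos_sum)
    then show ?thesis
      using c ab by (simp add: Ann_coset)
  qed
  have "a \<in> Ann A +> a" "b \<in> Ann A +> b"
    using ab N.subgroup_axioms mult.rcos_self by (simp_all add: Ann_coset)
  then show ?thesis
    unfolding rcoset_mult_def using * by blast
qed

lemma carrier_Quot_Ann: "carrier (A Quot Ann A) = (\<lambda>a. Ann A +> a) ` carrier A"
  by (auto simp: FactRing_def A_RCOSETS_def RCOSETS_def a_r_coset_def)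

lemma skew_left_brace_Quot_Ann: "skew_left_brace (A Quot Ann A)"
proof -
  let ?Q = "A Quot Ann A"
  interpret N: normal "Ann A" "add_monoid A"
    by (rule Ann_normal_add)
  have add_Q: "add_monoid ?Q = add_monoid A Mod Ann A"
    by (simp add: FactRing_def FactGroup_def A_RCOSETS_def set_add_def)
  have add_grp: "group (add_monoid ?Q)"
    unfolding add_Q by (rule N.factorgroup_is_group)
  have hom: "(\<lambda>a. Ann A +> a) \<in> hom A ?Q"
    unfolding hom_def carrier_Quot_Ann
    by (auto simp: FactRing_def Ann_coset_mult)
  have mult_grp: "group ?Q"
  proof -
    have "?Q \<lparr>carrier := (\<lambda>a. Ann A +> a) ` carrier A, one := Ann A +> \<one>\<rparr> = ?Q"
      unfolding carrier_Quot_Ann [symmetric] by (simp add: FactRing_def)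
    then show ?thesis
      using mult.hom_imp_img_group [OF hom] by simp
  qed
  have minus_Q: "\<ominus>\<^bsub>?Q\<^esub> (Ann A +> a) = Ann A +> (\<ominus> a)" if a: "a \<in> carrier A" for a
  proof -
    have "Ann A +> \<zero> = Ann A"
      using N.subset by (simp add: a_r_coset_def group.coset_mult_one [OF additive_group, simplified])
    then have "set_add A (Ann A +> \<ominus> a) (Ann A +> a) = Ann A"
      using a by (simp add: Ann_coset_add)
    moreover have "Ann A +> a \<in> carrier ?Q" "Ann A +> \<ominus> a \<in> carrier ?Q"
      using a by (auto simp: carrier_Quot_Ann)
    moreover have "zero ?Q = Ann A" "add ?Q = set_add A"
      by (simp_all add: FactRing_def)
    ultimately show ?thesis
      using group.inv_equality [OF add_grp, of "Ann A +> \<ominus> a" "Ann A +> a"]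
      by (simp add: a_inv_def)
  qed
  show ?thesis
  proof (rule skew_left_brace.intro [OF add_grp mult_grp])
    fix X Y Z
    assume "X \<in> carrier ?Q" "Y \<in> carrier ?Q" "Z \<in> carrier ?Q"
    then obtain a b c where abc: "a \<in> carrier A" "b \<in> carrier A" "c \<in> carrier A"
      and XYZ: "X = Ann A +> a" "Y = Ann A +> b" "Z = Ann A +> c"
      unfolding carrier_Quot_Ann by blast
    have ops: "add ?Q = set_add A" "mult ?Q = rcoset_mult A (Ann A)"
      by (simp_all add: FactRing_def)
    show "X \<otimes>\<^bsub>?Q\<^esub> (Y \<oplus>\<^bsub>?Q\<^esub> Z) = X \<otimes>\<^bsub>?Q\<^esub> Y \<ominus>\<^bsub>?Q\<^esub> X \<oplus>\<^bsub>?Q\<^esub> X \<otimes>\<^bsub>?Q\<^esub> Z"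
      using abc brace_distrib [OF abc]
      by (simp add: XYZ a_minus_def minus_Q ops Ann_coset_mult Ann_coset_add)
  qed
qed

end

end

theory Submission
  imports Defs "HOL-Algebra.Multiplicative_Group"
begin

text \<open>
  In the semidirect product \<open>(A,+) \<rtimes>\<^sub>\<lambda> (A,\<circ>)\<close> the subgroup \<open>Ann A \<times> Ann A\<close> is central, and every
  \<open>a * b\<close> is the commutator of \<open>(0,a)\<close> and \<open>(b,0)\<close>. Hence both finiteness claims of the first part
  follow from Schur's theorem (a group whose centre has finite index has finite derived subgroup)
  applied to this one group.

  For the converse let \<open>S\<close> be a finite generating set of \<open>(A,+)\<close>. An automorphism \<open>\<lambda>\<^sub>x\<close> is
  determined by the finitely many values \<open>x * s\<close>, and conjugation by \<open>x\<close> by the additive commutators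
  \<open>[x,s]\<close>, so only finitely many of each occur. Elements \<open>x, y\<close> with the same \<open>\<lambda>\<close>, inducing the
  same conjugation and with \<open>l x - x = l y - y\<close> for each of the finitely many automorphisms
  \<open>l = \<lambda>\<^sub>a\<close> lie in the same coset of the annihilator.
\<close>

section \<open>Schur's theorem\<close>

context group
begin

section \<open>Words in a conjugation-closed subset of a group\<close>

lemma mult_inv_cancel:
  assumes "x \<in> carrier G" "y \<in> carrier G"
  shows "x \<otimes> (inv x \<otimes> y) = y" "inv x \<otimes> (x \<otimes> y) = y"
  using assms by (simp_all add: m_assoc [symmetric])

lemma foldr_mult_closed:
  "set xs \<subseteq> carrier G \<Longrightarrow> foldr (\<otimes>) xs \<one> \<in> carrier G"
  by (induction xs) auto

lemma foldr_mult_append: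
  assumes "set xs \<subseteq> carrier G" "set ys \<subseteq> carrier G"
  shows "foldr (\<otimes>) (xs @ ys) \<one> = foldr (\<otimes>) xs \<one> \<otimes> foldr (\<otimes>) ys \<one>"
  using assms by (induction xs) (auto simp: foldr_mult_closed m_assoc)

lemma foldr_mult_replicate:
  assumes "x \<in> carrier G"
  shows "foldr (\<otimes>) (replicate n x) \<one> = x [^] n"
proof (induction n)
  case (Suc n)
  then show ?case using nat_pow_Suc2 [OF assms, of n] by simp
qed simp

text \<open>Closure of \<open>C\<close> under inverses makes words without inverse letters
  sufficient; writing them as lists gives a length for the later induction.\<close>

lemma generate_eq_foldr:
  assumes "C \<subseteq> carrier G" and inv: "\<And>c. c \<in> C \<Longrightarrow> inv c \<in> C"
    and "x \<in> generate G C"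
  shows "\<exists>xs. set xs \<subseteq> C \<and> x = foldr (\<otimes>) xs \<one>"
  using assms(3)
proof induction
  case one
  show ?case by (rule exI [of _ "[]"]) simp
next
  case (incl h)
  then show ?case using assms(1) by (intro exI [of _ "[h]"]) auto
next
  case (inv h)
  then show ?case using assms(1,2) by (intro exI [of _ "[inv h]"]) auto
next
  case (eng g h)
  then obtain xs ys where "set xs \<subseteq> C" "g = foldr (\<otimes>) xs \<one>" "set ys \<subseteq> C" "h = foldr (\<otimes>) ys \<one>"
    by blast
  then show ?case using assms(1)
    by (intro exI [of _ "xs @ ys"]) (simp add: foldr_mult_append [symmetric] subset_trans)
qed

text \<open>Since \<open>x c^k = c^k (c^-k x c^k)\<close>, a power of \<open>c\<close> passes to the
  left of a letter \<open>x\<close> at the cost of conjugating \<open>x\<close>, which keeps it in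
  \<open>C\<close> and keeps the number of letters.\<close>

lemma foldr_mult_move_to_front:
  assumes C: "C \<subseteq> carrier G"
    and conj: "\<And>g c. \<lbrakk>g \<in> carrier G; c \<in> C\<rbrakk> \<Longrightarrow> g \<otimes> c \<otimes> inv g \<in> C"
    and "set xs \<subseteq> C" "c \<in> carrier G" "k \<le> count_list xs c"
  shows "\<exists>ys. set ys \<subseteq> C \<and> length xs = k + length ys \<and>
           foldr (\<otimes>) xs \<one> = c [^] k \<otimes> foldr (\<otimes>) ys \<one>"
  using assms(3,5)
proof (induction xs arbitrary: k)
  case Nil
  then show ?case by simp
next
  case (Cons x xs)
  show ?case
  proof (cases k)
    case 0
    then show ?thesis
      using Cons.prems C foldr_mult_closed [of "x # xs"]
      by (intro exI [of _ "x # xs"]) (auto simp: subset_iff)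
  next
    case (Suc j)
    show ?thesis
    proof (cases "x = c")
      case True
      then obtain ys where ys: "set ys \<subseteq> C" "length xs = j + length ys"
          "foldr (\<otimes>) xs \<one> = c [^] j \<otimes> foldr (\<otimes>) ys \<one>"
        using Cons.IH [of j] Cons.prems Suc by auto
      moreover have "foldr (\<otimes>) ys \<one> \<in> carrier G"
        using ys C by (intro foldr_mult_closed) auto
      ultimately show ?thesis
        using True Suc assms(4) nat_pow_Suc2 [OF assms(4), of j]
        by (intro exI [of _ ys]) (simp add: m_assoc [symmetric])
    next
      case False
      then obtain ys where ys: "set ys \<subseteq> C" "length xs = k + length ys"
          "foldr (\<otimes>) xs \<one> = c [^] k \<otimes> foldr (\<otimes>) ys \<one>"
        using Cons.IH [of k] Cons.prems by auto
      have ysc: "foldr (\<otimes>) ys \<one> \<in> carrier G"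
        using ys C by (intro foldr_mult_closed) auto
      define p where "p = c [^] k"
      have p: "p \<in> carrier G" using assms(4) by (simp add: p_def)
      have x: "x \<in> carrier G" using Cons.prems C by auto
      have "inv p \<otimes> x \<otimes> p \<in> C"
        using conj [of "inv p" x] p Cons.prems by simp
      moreover have "p \<otimes> (inv p \<otimes> x \<otimes> p \<otimes> foldr (\<otimes>) ys \<one>) = x \<otimes> (p \<otimes> foldr (\<otimes>) ys \<one>)"
        using p x ysc by (simp add: m_assoc mult_inv_cancel)
      ultimately show ?thesis
        using ys by (intro exI [of _ "inv p \<otimes> x \<otimes> p # ys"]) (simp add: p_def)
    qed
  qed
qed

text \<open>
  A variant of Dietzmann's lemma, in which \<open>C\<close> would consist of elements of finite order. A word
  in \<open>C\<close> of length more than \<open>n * card C\<close> contains some letter at least \<open>n + 1\<close> times; collecting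
  these occurrences at the front and rewriting them by \<open>pow\<close> makes the word shorter.
\<close>

lemma finite_generate_normal_subset:
  assumes "finite C" and C: "C \<subseteq> carrier G"
    and inv: "\<And>c. c \<in> C \<Longrightarrow> inv c \<in> C"
    and conj: "\<And>g c. \<lbrakk>g \<in> carrier G; c \<in> C\<rbrakk> \<Longrightarrow> g \<otimes> c \<otimes> inv g \<in> C"
    and pow: "\<And>c. c \<in> C \<Longrightarrow>
      \<exists>ws. set ws \<subseteq> C \<and> length ws \<le> n \<and> foldr (\<otimes>) ws \<one> = c [^] Suc n"
  shows "finite (generate G C)"
proof -
  let ?W = "{xs. set xs \<subseteq> C \<and> length xs \<le> n * card C}"
  have short: "foldr (\<otimes>) xs \<one> \<in> (\<lambda>xs. foldr (\<otimes>) xs \<one>) ` ?W" if "set xs \<subseteq> C" for xs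
    using that
  proof (induction xs rule: length_induct)
    case (1 xs)
    show ?case
    proof (cases "length xs \<le> n * card C")
      case True
      then show ?thesis using 1 by blast
    next
      case False
      have "\<exists>c\<in>C. Suc n \<le> count_list xs c"
      proof (rule ccontr)
        assume "\<not> ?thesis"
        then have "sum (count_list xs) C \<le> card C * n"
          using sum_bounded_above [of C "count_list xs" n] by (simp add: not_less_eq_eq)
        then show False
          using False sum_count_set [of xs C] 1 \<open>finite C\<close> by (simp add: mult.commute)
      qed
      then obtain c where c: "c \<in> C" "Suc n \<le> count_list xs c" by blast
      obtain ys where ys: "set ys \<subseteq> C" "length xs = Suc n + length ys"
          "foldr (\<otimes>) xs \<one> = c [^] Suc n \<otimes> foldr (\<otimes>) ys \<one>"
        using foldr_mult_move_to_front [OF C conj, of xs c "Suc n"] 1 c C by blast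
      obtain ws where ws: "set ws \<subseteq> C" "length ws \<le> n" "foldr (\<otimes>) ws \<one> = c [^] Suc n"
        using pow c by blast
      have "foldr (\<otimes>) xs \<one> = foldr (\<otimes>) (ws @ ys) \<one>"
        using ws ys C foldr_mult_append [of ws ys] by (simp add: subset_trans)
      moreover have "foldr (\<otimes>) (ws @ ys) \<one> \<in> (\<lambda>xs. foldr (\<otimes>) xs \<one>) ` ?W"
        using ws ys by (intro 1(1) [rule_format]) auto
      ultimately show ?thesis by (simp only:)
    qed
  qed
  have "generate G C \<subseteq> (\<lambda>xs. foldr (\<otimes>) xs \<one>) ` ?W"
    using generate_eq_foldr [OF C inv] short by blast
  then show ?thesis
    using finite_lists_length_le [OF \<open>finite C\<close>] finite_surj by blast
qed

section \<open>Commutators modulo a central subgroup of finite index\<close>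

lemma conj_nat_pow:
  assumes "g \<in> carrier G" "x \<in> carrier G"
  shows "(g \<otimes> x \<otimes> inv g) [^] (n::nat) = g \<otimes> x [^] n \<otimes> inv g"
  using assms by (induction n) (simp_all add: m_assoc mult_inv_cancel)

lemma central_subgroup_normal:
  assumes "subgroup Z G" "Z \<subseteq> group_center G"
  shows "Z \<lhd> G"
proof (rule normal_invI [OF assms(1)])
  fix x z assume "x \<in> carrier G" "z \<in> Z"
  then have "x \<otimes> z \<otimes> inv x = z"
    using assms(2) by (smt (verit) group_center_def mem_Collect_eq subset_iff inv_solve_right' m_closed)
  then show "x \<otimes> z \<otimes> inv x \<in> Z" using \<open>z \<in> Z\<close> by simp
qed

text \<open>Allowing any central subgroup of finite index avoids computing the centre in the
  application. The commutators form a finite set closed under inverses and conjugation, and for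
  \<open>m\<close> the index of \<open>Z\<close> the power with exponent \<open>m + 1\<close> of
  each is a product of \<open>m\<close> commutators, so the variant of Dietzmann's lemma
  applies.\<close>

theorem schur:
  assumes Z: "subgroup Z G" "Z \<subseteq> group_center G" and fin: "finite (rcosets Z)"
  shows "finite (derived G (carrier G))"
proof -
  interpret Z: normal Z G using Z by (rule central_subgroup_normal)
  interpret Q: group "G Mod Z" by (rule Z.factorgroup_is_group)
  define m where "m = order (G Mod Z)"
  have "m > 0"
    using fin Q.order_gt_0_iff_finite by (simp add: m_def FactGroup_def)
  then obtain n where n: "m = Suc n"
    using gr0_implies_Suc by blast
  let ?c = "\<lambda>a b. a \<otimes> b \<otimes> inv a \<otimes> inv b"
  define C where "C = derived_set G (carrier G)"
  have central: "z \<otimes> x = x \<otimes> z" if "z \<in> Z" "x \<in> carrier G" for x z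
    using that Z(2) unfolding group_center_def by blast
  \<comment> \<open>The order of the quotient \<open>G Mod Z\<close> annihilates each of its
    elements.\<close>
  have pow_Z: "x [^] m \<in> Z" if x: "x \<in> carrier G" for x
  proof -
    have "Z #> x \<in> carrier (G Mod Z)" using x by (auto simp: carrier_FactGroup)
    then have "(Z #> x) [^]\<^bsub>G Mod Z\<^esub> m = Z"
      using Q.pow_order_eq_1 by (simp add: m_def)
    then have "Z #> x [^] m = Z" using x by (simp add: Z.FactGroup_pow)
    then show ?thesis using x Z.subgroup_axioms coset_join1 Z.subset by auto
  qed
  have C_carrier: "C \<subseteq> carrier G"
    unfolding C_def by (rule derived_set_in_carrier) simp
  have commI: "?c a b \<in> C" if "a \<in> carrier G" "b \<in> carrier G" for a b
    using that unfolding C_def by blast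
  have "finite C"
  proof -
    \<comment> \<open>\<open>r x\<close> depends on \<open>x\<close> only through its coset, so
      \<open>r\<close> takes finitely many values. Central factors cancel in a commutator, which is
      therefore determined by the representatives of its two entries.\<close>
    define r where "r x = (SOME t. t \<in> carrier G \<and> Z #> t = Z #> x)" for x
    have r: "r x \<in> carrier G" "Z #> r x = Z #> x" if "x \<in> carrier G" for x
      using someI [of "\<lambda>t. t \<in> carrier G \<and> Z #> t = Z #> x" x] that by (simp_all add: r_def)
    have ex: "\<exists>z\<in>Z. x = z \<otimes> r x" if "x \<in> carrier G" for x
      using rcos_self [OF that Z.subgroup_axioms] r [OF that] unfolding r_coset_def by blast
    have "r ` carrier G = (\<lambda>K. SOME t. t \<in> carrier G \<and> Z #> t = K) ` (rcosets Z)"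
      by (auto simp: r_def RCOSETS_def)
    then have finr: "finite (r ` carrier G)" using fin by simp
    have "?c a b = ?c (r a) (r b)" if ab: "a \<in> carrier G" "b \<in> carrier G" for a b
    proof -
      obtain z w where zw: "z \<in> Z" "w \<in> Z" "a = z \<otimes> r a" "b = w \<otimes> r b"
        using ex ab by meson
      have c: "z \<in> carrier G" "w \<in> carrier G" "r a \<in> carrier G" "r b \<in> carrier G"
        using zw ab r by auto
      have *: "?c (u \<otimes> s) t = ?c s t" "?c s (u \<otimes> t) = ?c s t"
        if "u \<in> Z" "s \<in> carrier G" "t \<in> carrier G" for u s t
      proof -
        have u: "u \<in> carrier G" using that by auto
        have absorb: "u \<otimes> w \<otimes> inv u = w" if "w \<in> carrier G" for w
          using central [OF \<open>u \<in> Z\<close> that] u that by (simp add: m_assoc)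
        show "?c (u \<otimes> s) t = ?c s t"
        proof -
          have "?c (u \<otimes> s) t = u \<otimes> (s \<otimes> t \<otimes> inv s) \<otimes> inv u \<otimes> inv t"
            using that u by (simp add: inv_mult_group m_assoc)
          then show ?thesis
            using absorb [of "s \<otimes> t \<otimes> inv s"] that by simp
        qed
        have "?c s (u \<otimes> t) = (s \<otimes> u) \<otimes> t \<otimes> inv s \<otimes> inv t \<otimes> inv u"
          using that u by (simp add: inv_mult_group m_assoc)
        also have "\<dots> = u \<otimes> ?c s t \<otimes> inv u"
          unfolding central [OF \<open>u \<in> Z\<close> \<open>s \<in> carrier G\<close>, symmetric]
          using that u by (simp add: m_assoc)
        finally show "?c s (u \<otimes> t) = ?c s t"
          using absorb [of "?c s t"] that by simp
      qed
      have "?c (z \<otimes> r a) (w \<otimes> r b) = ?c (r a) (r b)"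
        using zw(1,2) c * by simp
      then show ?thesis using zw(3,4) by simp
    qed
    then have "C \<subseteq> (\<Union>s\<in>r ` carrier G. \<Union>t\<in>r ` carrier G. {?c s t})"
      unfolding C_def by (intro UN_least) blast
    then show ?thesis by (rule finite_subset) (intro finite_UN_I finr finite.intros)
  qed
  moreover have "inv c \<in> C" if c_in: "c \<in> C" for c
  proof -
    obtain a b where ab: "a \<in> carrier G" "b \<in> carrier G" "c = ?c a b"
      using c_in unfolding C_def by auto
    then have "inv c = ?c b a" by (simp add: inv_mult_group m_assoc)
    then show ?thesis using ab(1,2) by (simp add: commI)
  qed
  moreover have conj: "g \<otimes> c \<otimes> inv g \<in> C" if g: "g \<in> carrier G" and c_in: "c \<in> C" for g c
  proof -
    obtain a b where ab: "a \<in> carrier G" "b \<in> carrier G" "c = ?c a b"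
      using c_in unfolding C_def by auto
    then have "g \<otimes> c \<otimes> inv g = ?c (g \<otimes> a \<otimes> inv g) (g \<otimes> b \<otimes> inv g)"
      using g by (simp add: inv_mult_group m_assoc mult_inv_cancel)
    then show ?thesis using ab(1,2) g by (simp add: commI)
  qed
  \<comment> \<open>As \<open>c\<^sup>m\<close> is central, \<open>c\<^sup>m\<^sup>+\<^sup>1 = c (b c b\<^sup>-\<^sup>1)\<^sup>m\<close>, and \<open>c (b c b\<^sup>-\<^sup>1) = [a, b\<^sup>2]\<close> for \<open>c = [a, b]\<close>.\<close>
  moreover have "\<exists>ws. set ws \<subseteq> C \<and> length ws \<le> m \<and> foldr (\<otimes>) ws \<one> = c [^] Suc m"
    if c_in: "c \<in> C" for c
  proof -
    obtain a b where ab: "a \<in> carrier G" "b \<in> carrier G" "c = ?c a b"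
      using c_in unfolding C_def by auto
    have c: "c \<in> carrier G" using ab by simp
    let ?d = "b \<otimes> c \<otimes> inv b"
    have d: "?d \<in> C" "?d \<in> carrier G" using conj [OF ab(2) c_in] ab(2) c by simp_all
    have "c [^] m = b \<otimes> c [^] m \<otimes> inv b"
      unfolding central [OF pow_Z [OF c] ab(2), symmetric] using ab(2) c by (simp add: m_assoc)
    then have pow_c: "c [^] m = ?d [^] Suc n"
      using conj_nat_pow [OF ab(2) c, of m] by (simp only: n)
    have mult_d: "c \<otimes> ?d = ?c a (b \<otimes> b)"
      using ab(1,2) by (simp add: ab(3) inv_mult_group m_assoc mult_inv_cancel)
    have "c [^] Suc m = c \<otimes> ?d [^] Suc n"
      by (simp only: nat_pow_Suc2 [OF c] pow_c)
    also have "\<dots> = ?c a (b \<otimes> b) \<otimes> ?d [^] n"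
      unfolding mult_d [symmetric] using c d(2) by (simp only: nat_pow_Suc2 m_assoc nat_pow_closed)
    \<comment> \<open>This word has \<open>1 + n = m\<close> letters, one fewer than the exponent
      \<open>Suc m\<close>: here words become shorter.\<close>
    finally have "foldr (\<otimes>) (?c a (b \<otimes> b) # replicate n ?d) \<one> = c [^] Suc m"
      using foldr_mult_replicate [OF d(2), of n] by simp
    moreover have "?c a (b \<otimes> b) \<in> C" using ab(1,2) by (simp add: commI)
    ultimately show ?thesis
      using d n by (intro exI [of _ "?c a (b \<otimes> b) # replicate n ?d"]) auto
  qed
  ultimately show ?thesis
    unfolding derived_def C_def [symmetric] by (rule finite_generate_normal_subset [OF _ C_carrier]) simp_all
qed

end

section \<open>The semidirect product of a skew left brace\<close>

definition brace_semidirect :: "('a, 'm) ring_scheme \<Rightarrow> ('a \<times> 'a) monoid"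
  where "brace_semidirect A =
    \<lparr>carrier = carrier A \<times> carrier A,
     mult = (\<lambda>(b, a) (d, c). (b \<oplus>\<^bsub>A\<^esub> brace_lambda A a d, a \<otimes>\<^bsub>A\<^esub> c)),
     one = (\<zero>\<^bsub>A\<^esub>, \<one>\<^bsub>A\<^esub>)\<rparr>"

lemma brace_semidirect_simps [simp]:
  "carrier (brace_semidirect A) = carrier A \<times> carrier A"
  "(b, a) \<otimes>\<^bsub>brace_semidirect A\<^esub> (d, c) = (b \<oplus>\<^bsub>A\<^esub> brace_lambda A a d, a \<otimes>\<^bsub>A\<^esub> c)"
  "\<one>\<^bsub>brace_semidirect A\<^esub> = (\<zero>\<^bsub>A\<^esub>, \<one>\<^bsub>A\<^esub>)"
  by (simp_all add: brace_semidirect_def)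

context skew_left_brace
begin

lemma lambda_zero: "a \<in> carrier A \<Longrightarrow> brace_lambda A a \<zero> = \<zero>"
  using lambda_add [of a \<zero> \<zero>] by simp

lemma Ann_lambda: "\<lbrakk>z \<in> Ann A; b \<in> carrier A\<rbrakk> \<Longrightarrow> brace_lambda A z b = b"
  by (simp add: lambda_apply Ann_mult Ann_carrier add.m_assoc [symmetric])

lemma group_brace_semidirect: "group (brace_semidirect A)"
proof (rule groupI)
  fix x assume "x \<in> carrier (brace_semidirect A)"
  then obtain b a where x: "x = (b, a)" "b \<in> carrier A" "a \<in> carrier A" by auto
  have "(brace_lambda A (inv a) (\<ominus> b), inv a) \<otimes>\<^bsub>brace_semidirect A\<^esub> x = \<one>\<^bsub>brace_semidirect A\<^esub>"
    using x by (simp add: lambda_add [symmetric] lambda_zero)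
  then show "\<exists>y\<in>carrier (brace_semidirect A).
      y \<otimes>\<^bsub>brace_semidirect A\<^esub> x = \<one>\<^bsub>brace_semidirect A\<^esub>"
    using x by (intro bexI [of _ "(brace_lambda A (inv a) (\<ominus> b), inv a)"]) auto
qed (auto simp: lambda_add lambda_mult lambda_one add.m_assoc mult.m_assoc)

lemma brace_semidirect_inv_fst:
  "b \<in> carrier A \<Longrightarrow> inv\<^bsub>brace_semidirect A\<^esub> (b, \<one>) = (\<ominus> b, \<one>)"
  by (rule group.inv_equality [OF group_brace_semidirect]) (simp_all add: lambda_one)

lemma brace_semidirect_inv_snd:
  "a \<in> carrier A \<Longrightarrow> inv\<^bsub>brace_semidirect A\<^esub> (\<zero>, a) = (\<zero>, inv a)"
  by (rule group.inv_equality [OF group_brace_semidirect]) (simp_all add: lambda_zero)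

text \<open>Conjugating \<open>(b, \<one>)\<close> by \<open>(\<zero>, a)\<close> gives
  \<open>(brace_lambda A a b, \<one>)\<close>; the last factor then subtracts
  \<open>b\<close>.\<close>

lemma brace_star_eq_commutator:
  assumes "a \<in> carrier A" "b \<in> carrier A"
  shows "(brace_star A a b, \<one>) =
    (\<zero>, a) \<otimes>\<^bsub>brace_semidirect A\<^esub> (b, \<one>) \<otimes>\<^bsub>brace_semidirect A\<^esub>
    inv\<^bsub>brace_semidirect A\<^esub> (\<zero>, a) \<otimes>\<^bsub>brace_semidirect A\<^esub> inv\<^bsub>brace_semidirect A\<^esub> (b, \<one>)"
  using assms
  by (simp add: brace_semidirect_inv_fst brace_semidirect_inv_snd lambda_zero lambda_one
      brace_star_def a_minus_def)

text \<open>Annihilator elements act trivially through \<lambda>, and both operations agree on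
  \<open>Ann A\<close>, so products and inverses are componentwise.\<close>

lemma Ann_times_Ann_subgroup: "subgroup (Ann A \<times> Ann A) (brace_semidirect A)"
proof (rule group.subgroupI [OF group_brace_semidirect])
  show "Ann A \<times> Ann A \<noteq> {}" using zero_in_Ann by auto
  fix x assume "x \<in> Ann A \<times> Ann A"
  then obtain z w where x: "x = (z, w)" "z \<in> Ann A" "w \<in> Ann A" by auto
  have w: "inv w \<in> Ann A" using x(3) by (simp add: Ann_minus_closed)
  with x have "inv\<^bsub>brace_semidirect A\<^esub> x = (\<ominus> z, inv w)"
    by (intro group.inv_equality [OF group_brace_semidirect]) (simp_all add: Ann_carrier Ann_lambda)
  then show "inv\<^bsub>brace_semidirect A\<^esub> x \<in> Ann A \<times> Ann A"
    using x w by (simp add: Ann_minus_closed(1))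
next
  fix x y assume "x \<in> Ann A \<times> Ann A" "y \<in> Ann A \<times> Ann A"
  then show "x \<otimes>\<^bsub>brace_semidirect A\<^esub> y \<in> Ann A \<times> Ann A"
    by (auto simp: Ann_lambda Ann_mult Ann_add_closed Ann_carrier)
qed (auto simp: Ann_carrier)

text \<open>For \<open>(z, w)\<close> in this set, \<open>w\<close> acts trivially and every
  \<lambda> fixes \<open>z\<close>; what remains is centrality of \<open>z\<close> in the additive
  and of \<open>w\<close> in the multiplicative group.\<close>

lemma Ann_times_Ann_central: "Ann A \<times> Ann A \<subseteq> group_center (brace_semidirect A)"
  by (auto simp: group_center_def Ann_carrier Ann_lambda lambda_Ann Ann_add_commute Ann_mult_commute)

text \<open>Cosets are thus products of two elements of the quotient brace, so a finite quotient
  makes the index of \<open>Ann A \<times> Ann A\<close> finite.\<close>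

lemma Ann_times_Ann_coset:
  assumes "b \<in> carrier A" "a \<in> carrier A"
  shows "(Ann A \<times> Ann A) #>\<^bsub>brace_semidirect A\<^esub> (b, a) = (Ann A +> b) \<times> (Ann A +> a)"
  using assms by (auto simp: r_coset_def a_r_coset_def Ann_lambda Ann_mult)

section \<open>Finiteness of \<open>brace_square A\<close> and
  \<open>additive_commutator A\<close>\<close>

lemma finite_derived_brace_semidirect:
  assumes "finite (carrier (A Quot Ann A))"
  shows "finite (derived (brace_semidirect A) (carrier (brace_semidirect A)))"
proof (rule group.schur [OF group_brace_semidirect Ann_times_Ann_subgroup Ann_times_Ann_central])
  let ?Q = "carrier (A Quot Ann A)"
  have "rcosets\<^bsub>brace_semidirect A\<^esub> (Ann A \<times> Ann A) \<subseteq> (\<Union>X\<in>?Q. \<Union>Y\<in>?Q. {X \<times> Y})"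
    unfolding carrier_Quot_Ann by (auto simp: RCOSETS_def Ann_times_Ann_coset) blast
  then show "finite (rcosets\<^bsub>brace_semidirect A\<^esub> (Ann A \<times> Ann A))"
    by (rule finite_subset) (intro finite_UN_I assms finite.intros)
qed

lemma group_hom_brace_semidirect:
  "group_hom (add_monoid A) (brace_semidirect A) (\<lambda>b. (b, \<one>))"
  using group_brace_semidirect additive_group
  by (auto simp: group_hom_def group_hom_axioms_def hom_def lambda_one)

text \<open>The injective homomorphism sending \<open>b\<close> to \<open>(b, \<one>)\<close>
  carries the subgroup generated by \<open>K\<close> into the derived subgroup of the semidirect
  product, which is finite by Schur's theorem.\<close>

lemma finite_generate_of_commutators:
  assumes fin: "finite (carrier (A Quot Ann A))" and K: "K \<subseteq> carrier A"
    and comm: "\<And>k. k \<in> K \<Longrightarrow>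
      (k, \<one>) \<in> derived_set (brace_semidirect A) (carrier (brace_semidirect A))"
  shows "finite (generate (add_monoid A) K)"
proof -
  interpret h: group_hom "add_monoid A" "brace_semidirect A" "\<lambda>b. (b, \<one>)"
    by (rule group_hom_brace_semidirect)
  have "(\<lambda>b. (b, \<one>)) ` generate (add_monoid A) K
      = generate (brace_semidirect A) ((\<lambda>b. (b, \<one>)) ` K)"
    using K by (intro h.generate_img [symmetric]) simp
  also have "\<dots> \<subseteq> derived (brace_semidirect A) (carrier (brace_semidirect A))"
    unfolding derived_def using comm by (intro h.H.mono_generate) blast
  finally have "finite ((\<lambda>b. (b, \<one>)) ` generate (add_monoid A) K)"
    using finite_derived_brace_semidirect [OF fin] finite_subset by blast
  then show ?thesis
    by (rule finite_imageD) (simp add: inj_on_def)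
qed

lemma finite_brace_square:
  assumes "finite (carrier (A Quot Ann A))"
  shows "finite (brace_square A)"
  unfolding brace_square_def
proof (rule finite_generate_of_commutators [OF assms])
  fix k assume "k \<in> {brace_star A a b |a b. a \<in> carrier A \<and> b \<in> carrier A}"
  then obtain a b where "a \<in> carrier A" "b \<in> carrier A" "k = brace_star A a b" by blast
  then show "(k, \<one>) \<in> derived_set (brace_semidirect A) (carrier (brace_semidirect A))"
    using brace_star_eq_commutator [of a b]
    by (intro UN_I [of "(\<zero>, a)"] UN_I [of "(b, \<one>)"]) simp_all
qed (auto simp: brace_star_def a_minus_def)

lemma finite_additive_commutator:
  assumes "finite (carrier (A Quot Ann A))"
  shows "finite (additive_commutator A)"
  unfolding additive_commutator_def derived_def
proof (rule finite_generate_of_commutators [OF assms])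
  fix k assume "k \<in> derived_set (add_monoid A) (carrier A)"
  then obtain a b where ab: "a \<in> carrier A" "b \<in> carrier A" "k = a \<oplus> b \<oplus> \<ominus> a \<oplus> \<ominus> b"
    by (auto simp: a_inv_def)
  \<comment> \<open>As \<open>\<one>\<close> acts trivially, \<open>k\<close> is already a
    commutator of \<open>(a, \<one>)\<close> and \<open>(b, \<one>)\<close>.\<close>
  then show "(k, \<one>) \<in> derived_set (brace_semidirect A) (carrier (brace_semidirect A))"
    by (intro UN_I [of "(a, \<one>)"] UN_I [of "(b, \<one>)"])
      (simp_all add: brace_semidirect_inv_fst lambda_one)
qed (auto simp: a_inv_def [symmetric])

end

section \<open>Braces with finitely generated additive group\<close>

lemma hom_eq_on_generate:
  assumes "group G" "group H" "h \<in> hom G H" "k \<in> hom G H" "S \<subseteq> carrier G"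
    and "\<And>s. s \<in> S \<Longrightarrow> h s = k s" and "x \<in> generate G S"
  shows "h x = k x"
proof -
  interpret h: group_hom G H h using assms by (simp add: group_hom_def group_hom_axioms_def)
  interpret k: group_hom G H k using assms by (simp add: group_hom_def group_hom_axioms_def)
  show ?thesis
    using assms(7)
  proof induction
    case (eng x y)
    then have "x \<in> carrier G" "y \<in> carrier G"
      using h.G.generate_in_carrier [OF assms(5)] by auto
    then show ?case using eng by simp
  qed (use assms(5,6) in \<open>auto simp: subset_iff\<close>)
qed

text \<open>On \<open>X\<close> the map \<open>g\<close> factors through \<open>f\<close>;
  \<open>inv_into\<close> chooses a preimage of each value of \<open>f\<close>.\<close>

lemma finite_image_cong:
  assumes "finite (f ` X)" "\<And>x y. \<lbrakk>x \<in> X; y \<in> X; f x = f y\<rbrakk> \<Longrightarrow> g x = g y"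
  shows "finite (g ` X)"
proof -
  have "g x = g (inv_into X f (f x))" if "x \<in> X" for x
    using that by (intro assms(2)) (simp_all add: inv_into_into f_inv_into_f)
  then have "g ` X \<subseteq> (\<lambda>v. g (inv_into X f v)) ` f ` X" by blast
  then show ?thesis using assms(1) finite_surj by blast
qed

lemma finite_image_restrict:
  assumes "finite S" "\<And>s. s \<in> S \<Longrightarrow> finite ((\<lambda>x. h x s) ` X)"
  shows "finite ((\<lambda>x. \<lambda>s\<in>S. h x s) ` X)"
proof (rule finite_subset)
  show "(\<lambda>x. \<lambda>s\<in>S. h x s) ` X \<subseteq> (\<Pi>\<^sub>E s\<in>S. (\<lambda>x. h x s) ` X)" by auto
  show "finite (\<Pi>\<^sub>E s\<in>S. (\<lambda>x. h x s) ` X)" using assms by (intro finite_PiE)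
qed

context skew_left_brace
begin

section \<open>Data determining a coset of the annihilator\<close>

lemma lambda_hom_add:
  "a \<in> carrier A \<Longrightarrow> brace_lambda A a \<in> hom (add_monoid A) (add_monoid A)"
  by (simp add: hom_def lambda_add)

lemma brace_star_in_square:
  "\<lbrakk>a \<in> carrier A; b \<in> carrier A\<rbrakk> \<Longrightarrow> brace_star A a b \<in> brace_square A"
  unfolding brace_square_def by (intro generate.incl) blast

lemma commutator_in_additive_commutator:
  "\<lbrakk>a \<in> carrier A; b \<in> carrier A\<rbrakk> \<Longrightarrow> a \<oplus> b \<oplus> \<ominus> a \<oplus> \<ominus> b \<in> additive_commutator A"
  unfolding additive_commutator_def derived_def by (intro generate.incl) (auto simp: a_inv_def)

lemma conj_hom_add:
  assumes "x \<in> carrier A"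
  shows "(\<lambda>b. x \<oplus> b \<oplus> \<ominus> x) \<in> hom (add_monoid A) (add_monoid A)"
  using assms by (simp add: hom_def add.m_assoc add.mult_inv_cancel)

text \<open>Put \<open>k = x \<otimes> inv y\<close>. It acts trivially by \<open>lam\<close>, so
  \<open>x = k \<otimes> y = k \<oplus> y\<close> and \<open>k\<close> is the difference. Equal
  conjugations make \<open>k\<close> additively central, and \<open>star\<close> makes every
  \<lambda> fix \<open>k\<close>; hence
  \<open>a \<otimes> k = a \<oplus> k = k \<oplus> a = k \<otimes> a\<close>.\<close>

lemma diff_in_Ann:
  assumes x: "x \<in> carrier A" and y: "y \<in> carrier A"
    and lam: "\<And>b. b \<in> carrier A \<Longrightarrow> brace_lambda A x b = brace_lambda A y b"
    and conj: "\<And>b. b \<in> carrier A \<Longrightarrow> x \<oplus> b \<oplus> \<ominus> x = y \<oplus> b \<oplus> \<ominus> y"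
    and star: "\<And>a. a \<in> carrier A \<Longrightarrow> brace_star A a x = brace_star A a y"
  shows "x \<ominus> y \<in> Ann A"
proof -
  define k where "k = x \<otimes> inv y"
  have k: "k \<in> carrier A" using x y by (simp add: k_def)
  have lam_k: "brace_lambda A k b = b" if b: "b \<in> carrier A" for b
    using x y b lam [of "brace_lambda A (inv y) b"]
    by (simp add: k_def lambda_mult lambda_mult [of y "inv y", symmetric] lambda_one)
  then have mult_k: "k \<otimes> b = k \<oplus> b" if "b \<in> carrier A" for b
    using k that by (simp add: mult_eq_lambda)
  have "x = k \<otimes> y" using x y by (simp add: k_def mult.m_assoc)
  then have xk: "x = k \<oplus> y" using mult_k y by simp
  have comm_k: "k \<oplus> b = b \<oplus> k" if b: "b \<in> carrier A" for b
  proof -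
    let ?b = "\<ominus> y \<oplus> b \<oplus> y"
    have "k \<oplus> b \<oplus> \<ominus> k = x \<oplus> ?b \<oplus> \<ominus> x"
      using k y b by (simp add: xk add.inv_mult_group add.m_assoc add.mult_inv_cancel)
    also have "\<dots> = b"
      using conj [of ?b] y b by (simp add: add.m_assoc add.mult_inv_cancel)
    finally show ?thesis using k b by (metis add.inv_solve_right' add.m_closed)
  qed
  have fix_k: "brace_lambda A a k = k" if a: "a \<in> carrier A" for a
  proof -
    \<comment> \<open>Both sides equal \<open>brace_lambda A a x\<close>. Writing \<open>x\<close>
      as \<open>y \<oplus> k\<close>, by centrality of \<open>k\<close>, lets the
      \<open>\<ominus> y\<close> inside \<open>brace_star A a y\<close> cancel.\<close>
    have "brace_lambda A a k \<oplus> brace_lambda A a y = brace_star A a x \<oplus> x"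
      using a k y by (simp add: brace_star_def a_minus_def xk lambda_add add.m_assoc)
    also have "\<dots> = brace_star A a y \<oplus> (y \<oplus> k)"
      using star [OF a] comm_k [OF y] by (simp add: xk)
    also have "\<dots> = k \<oplus> brace_lambda A a y"
      using a k y by (simp add: brace_star_def a_minus_def add.m_assoc add.mult_inv_cancel comm_k)
    finally show ?thesis using a k y by simp
  qed
  have "k \<in> Ann A"
    using k mult_k comm_k fix_k by (intro AnnI) (simp_all add: mult_eq_lambda)
  moreover have "x \<ominus> y = k" using k y by (simp add: xk a_minus_def add.m_assoc)
  ultimately show ?thesis by simp
qed

lemma finite_Quot_Ann:
  assumes fg: "finitely_generated_group (add_monoid A)"
    and sq: "finite (brace_square A)" and comm: "finite (additive_commutator A)"
  shows "finite (carrier (A Quot Ann A))"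
proof -
  obtain S where S: "finite S" "S \<subseteq> carrier A" "generate (add_monoid A) S = carrier A"
    using fg by (auto simp: finitely_generated_group_def)
  have on_gens: "h b = k b"
    if "h \<in> hom (add_monoid A) (add_monoid A)" "k \<in> hom (add_monoid A) (add_monoid A)"
      "\<And>s. s \<in> S \<Longrightarrow> h s = k s" "b \<in> carrier A" for h k b
    by (rule hom_eq_on_generate [OF additive_group additive_group that(1,2) _ that(3)])
      (use S that(4) in auto)
  let ?star = "\<lambda>x. \<lambda>s\<in>S. brace_star A x s"
  let ?conj = "\<lambda>x. \<lambda>s\<in>S. x \<oplus> s \<oplus> \<ominus> x \<oplus> \<ominus> s"
  let ?L = "brace_lambda A ` carrier A"
  \<comment> \<open>Indexing by the automorphisms in \<open>?L\<close> rather than by elements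
    \<open>a\<close> gives a finite index set once \<open>fin_L\<close> is known, yet still records
    all values \<open>brace_star A a x\<close>.\<close>
  let ?act = "\<lambda>x. \<lambda>l\<in>?L. l x \<ominus> x"
  have lam: "brace_lambda A x = brace_lambda A y"
    if xy: "x \<in> carrier A" "y \<in> carrier A" and eq: "?star x = ?star y" for x y
  proof (rule extensionalityI [of _ "carrier A"])
    fix b assume b: "b \<in> carrier A"
    have "brace_lambda A x s = brace_lambda A y s" if s: "s \<in> S" for s
    proof -
      have "brace_star A x s = brace_star A y s" using fun_cong [OF eq, of s] s by simp
      then show ?thesis using xy s S(2) by (auto simp: brace_star_def a_minus_def)
    qed
    then show "brace_lambda A x b = brace_lambda A y b"
      using on_gens [OF lambda_hom_add lambda_hom_add] xy b by blast
  qed (simp_all add: brace_lambda_def)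
  \<comment> \<open>All entries of these tuples lie in the finite set \<open>brace_square A\<close>;
    the same holds for \<open>?act\<close>, and for \<open>?conj\<close> with
    \<open>additive_commutator A\<close>.\<close>
  have fin_star: "finite (?star ` carrier A)"
    using S brace_star_in_square
    by (intro finite_image_restrict [OF S(1)] finite_subset [OF _ sq]) auto
  have fin_L: "finite ?L"
    using fin_star lam by (rule finite_image_cong)
  have fin_conj: "finite (?conj ` carrier A)"
    using S commutator_in_additive_commutator
    by (intro finite_image_restrict [OF S(1)] finite_subset [OF _ comm]) auto
  have fin_act: "finite (?act ` carrier A)"
    using brace_star_in_square
    by (intro finite_image_restrict [OF fin_L] finite_subset [OF _ sq]) (auto simp: brace_star_def)
  \<comment> \<open>The coset of \<open>x\<close> depends only on this triple, which takes finitely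
    many values.\<close>
  have "finite ((\<lambda>x. (?star x, ?conj x, ?act x)) ` carrier A)"
    by (rule finite_subset [OF _ finite_cartesian_product
            [OF fin_star finite_cartesian_product [OF fin_conj fin_act]]]) auto
  then have "finite ((\<lambda>x. Ann A +> x) ` carrier A)"
  proof (rule finite_image_cong)
    fix x y assume xy: "x \<in> carrier A" "y \<in> carrier A"
      and "(?star x, ?conj x, ?act x) = (?star y, ?conj y, ?act y)"
    then have eq: "?star x = ?star y" "?conj x = ?conj y" "?act x = ?act y"
      by (simp_all only: prod.inject)
    have conj: "x \<oplus> b \<oplus> \<ominus> x = y \<oplus> b \<oplus> \<ominus> y" if "b \<in> carrier A" for b
    proof (rule on_gens [OF conj_hom_add conj_hom_add, OF xy _ that])
      fix s assume s: "s \<in> S"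
      then show "x \<oplus> s \<oplus> \<ominus> x = y \<oplus> s \<oplus> \<ominus> y"
        using fun_cong [OF eq(2), of s] xy S(2) by (simp add: subset_iff)
    qed
    have star: "brace_star A a x = brace_star A a y" if "a \<in> carrier A" for a
      using that fun_cong [OF eq(3), of "brace_lambda A a"] by (simp add: brace_star_def)
    have "x \<ominus> y \<in> Ann A"
      using lam [OF xy eq(1)] conj star by (intro diff_in_Ann xy) (simp_all only:)
    then have "x \<in> Ann A +> y"
      using xy by (force simp: a_r_coset_def r_coset_def a_minus_def add.m_assoc)
    then show "Ann A +> x = Ann A +> y"
      using add.repr_independence [of x "Ann A" y] xy Ann_normal_add
      by (simp add: a_r_coset_def normal_def)
  qed
  then show ?thesis by (simp add: carrier_Quot_Ann)
qed

end

theorem theorem5p4: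
  fixes A :: "('a, 'm) ring_scheme"
  assumes "skew_left_brace A"
  shows "(finite (carrier (A Quot Ann A)) \<longrightarrow>
            finite (brace_square A) \<and> finite (additive_commutator A)) \<and>
         (finitely_generated_group (add_monoid A) \<and>
            finite (brace_square A) \<and> finite (additive_commutator A) \<longrightarrow>
            finite (carrier (A Quot Ann A)))"
proof -
  interpret skew_left_brace A by fact
  show ?thesis
    using finite_brace_square finite_additive_commutator finite_Quot_Ann by blast
qed

end
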